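(* For every integer $v\geq 6$, $t(\overline{T_v})=\frac{v}{2}-1=\frac{k}{-\lambda_{min}}$, where $k=\binom{v-2}{2}$ is the degree of the regular graph $\overline{T_v}$ and $\lambda_{min}$ is the smallest eigenvalue of its adjacency matrix. Furthermore, if $S$ is a disconnecting set of vertices in $\overline{T_v}$ such that $\frac{|S|}{c(\overline{T_v}\setminus S)}=\frac{v}{2}-1$, then $S$ is the complement of an independent set of maximum size in $\overline{T_v}$.
   Context: All graphs are finite, simple and undirected. $\overline{T_v}$ is the complement of the Triangular graph $T_v$ (the line graph of $K_v$); its vertices are the $2$-subsets of a set with $v$ elements, two of them being adjacent if and only if they are disjoint. For a connected graph $G$ and a vertex subset $S$, $c(G\setminus S)$ denotes the number of connected components of the graph obtained from $G$ by removing the vertices of $S$; $S$ is called disconnecting if $c(G\setminus S)\ge 2$. The toughness of $G$ is $t(G)=\min_S \frac{|S|}{c(G\setminus S)}$, the minimum being over all disconnecting vertex sets $S$. *)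

theory Defs
  imports "Graph_Theory.Graph_Theory" "Jordan_Normal_Form.Char_Poly"
begin

text \<open>
  Simple undirected graphs are modelled, as in \<^theory>\<open>Graph_Theory.Digraph\<close>, by symmetric
  loop-free digraphs without parallel arcs: each edge is a pair of opposite arcs.
\<close>

section \<open>Complements of triangular graphs\<close>

definition complete_graph :: "'a set \<Rightarrow> 'a pair_pre_digraph" where
  "complete_graph X =
     \<lparr> pverts = X, parcs = {(x, y). x \<in> X \<and> y \<in> X \<and> x \<noteq> y} \<rparr>"

definition line_graph :: "'a pair_pre_digraph \<Rightarrow> 'a set pair_pre_digraph" where
  "line_graph G =
     (let E = {{x, y} | x y. (x, y) \<in> parcs G} in
      \<lparr> pverts = E, parcs = {(e, f). e \<in> E \<and> f \<in> E \<and> e \<noteq> f \<and> e \<inter> f \<noteq> {}} \<rparr>)"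

definition complement_graph :: "'a pair_pre_digraph \<Rightarrow> 'a pair_pre_digraph" where
  "complement_graph G =
     \<lparr> pverts = pverts G,
       parcs = {(x, y). x \<in> pverts G \<and> y \<in> pverts G \<and> x \<noteq> y \<and> (x, y) \<notin> parcs G} \<rparr>"

definition triangular_graph :: "'a set \<Rightarrow> 'a set pair_pre_digraph" where
  "triangular_graph X = line_graph (complete_graph X)"

lemma complete_digraph_complete_graph:
  assumes "finite X"
  shows "K\<^bsub>card X\<^esub> (with_proj (complete_graph X))"
  using assms by (auto simp: complete_digraph_pair_def complete_graph_def)

lemma pverts_triangular_graph:
  "pverts (triangular_graph X) = {e. e \<subseteq> X \<and> card e = 2}"
  by (auto simp: triangular_graph_def line_graph_def complete_graph_def Let_def card_2_iff)

lemma pverts_complement_triangular_graph: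
  "pverts (complement_graph (triangular_graph X)) = {e. e \<subseteq> X \<and> card e = 2}"
  by (simp add: complement_graph_def pverts_triangular_graph)

lemma parcs_complement_triangular_graph:
  "(e, f) \<in> parcs (complement_graph (triangular_graph X)) \<longleftrightarrow>
     e \<subseteq> X \<and> card e = 2 \<and> f \<subseteq> X \<and> card f = 2 \<and> e \<inter> f = {}"
proof -
  have "parcs (triangular_graph X) =
      {(e, f). e \<in> pverts (triangular_graph X) \<and> f \<in> pverts (triangular_graph X)
             \<and> e \<noteq> f \<and> e \<inter> f \<noteq> {}}"
    by (simp add: triangular_graph_def line_graph_def Let_def)
  then show ?thesis
    by (auto simp: complement_graph_def pverts_triangular_graph)
qed

lemma pair_graph_complement_triangular_graph:
  assumes "finite X"
  shows "pair_graph (complement_graph (triangular_graph X))" (is "pair_graph ?G")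
proof -
  have fin: "finite (pverts ?G)"
    using assms by (simp add: pverts_complement_triangular_graph)
  moreover have "parcs ?G \<subseteq> pverts ?G \<times> pverts ?G"
    by (auto simp: complement_graph_def)
  ultimately have "finite (parcs ?G)"
    by (meson finite_SigmaI finite_subset)
  moreover have "sym (parcs ?G)"
    by (rule symI) (simp add: parcs_complement_triangular_graph Int_commute)
  moreover have "e \<in> pverts ?G \<and> f \<in> pverts ?G \<and> e \<noteq> f" if "(e, f) \<in> parcs ?G" for e f
    using that by (auto simp: complement_graph_def)
  ultimately show ?thesis
    using fin by unfold_locales (auto simp: symmetric_def)
qed

section \<open>Toughness\<close>

text \<open>In a symmetric digraph the strongly connected components are the connected components.\<close>

definition num_components :: "('a, 'b) pre_digraph \<Rightarrow> nat" where
  "num_components G = card (pre_digraph.sccs G)"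

definition del_verts :: "('a, 'b) pre_digraph \<Rightarrow> 'a set \<Rightarrow> ('a, 'b) pre_digraph" where
  "del_verts G S = G \<restriction> (verts G - S)"

definition disconnecting_set :: "('a, 'b) pre_digraph \<Rightarrow> 'a set \<Rightarrow> bool" where
  "disconnecting_set G S \<longleftrightarrow> S \<subseteq> verts G \<and> num_components (del_verts G S) \<ge> 2"

text \<open>
  Meaningful only for finite graphs that have a disconnecting set, that is, non-complete ones:
  otherwise the minimum is taken over the empty set and its value is unspecified.
\<close>

definition toughness :: "('a, 'b) pre_digraph \<Rightarrow> real" where
  "toughness G =
     Min {real (card S) / real (num_components (del_verts G S)) | S. disconnecting_set G S}"

section \<open>Independent sets\<close>

definition independent_set :: "('a, 'b) pre_digraph \<Rightarrow> 'a set \<Rightarrow> bool" where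
  "independent_set G I \<longleftrightarrow> I \<subseteq> verts G \<and> (\<forall>x\<in>I. \<forall>y\<in>I. \<not> x \<rightarrow>\<^bsub>G\<^esub> y)"

definition maximum_independent_set :: "('a, 'b) pre_digraph \<Rightarrow> 'a set \<Rightarrow> bool" where
  "maximum_independent_set G I \<longleftrightarrow>
     independent_set G I \<and> (\<forall>J. independent_set G J \<longrightarrow> card J \<le> card I)"

section \<open>Adjacency matrices\<close>

text \<open>The list fixes an ordering of the vertices; the spectrum does not depend on it.\<close>

definition adjacency_matrix :: "('a, 'b) pre_digraph \<Rightarrow> 'a list \<Rightarrow> real mat" where
  "adjacency_matrix G vs =
     mat (length vs) (length vs) (\<lambda>(i, j). if vs ! i \<rightarrow>\<^bsub>G\<^esub> vs ! j then 1 else 0)"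

text \<open>A real symmetric matrix has only real eigenvalues, so none is missed here.\<close>

definition smallest_eigenvalue :: "real mat \<Rightarrow> real" where
  "smallest_eigenvalue A = Min {l. eigenvalue A l}"

end

theory Submission
  imports Defs "Jordan_Normal_Form.Spectral_Radius"
begin

text \<open>
  Vertices in different components of what remains after deleting \<open>S\<close> are intersecting pairs.
  If there are at least four components, one vertex from each gives four pairwise intersecting
  pairs, which must share a point \<open>x\<close>; every remaining pair meets three of them and hence
  contains \<open>x\<close> too. So the remaining pairs lie in a star, whose size \<open>v - 1\<close> bounds the number
  of components. With two or three components, intersection conditions alone leave so few pairs
  that the bound is strict. For the spectrum, an eigenvector \<open>y\<close> satisfies
  \<open>(l - 1) y {i, j} = s - d i - d j\<close>, where \<open>s\<close> is the sum of all entries and \<open>d i\<close> the sum over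
  the star at \<open>i\<close>; summing over stars leaves only three possible eigenvalues.
\<close>

section \<open>Cross-intersecting families of pairs\<close>

abbreviation pairs :: "'a set \<Rightarrow> 'a set set" where
  "pairs X \<equiv> {e. e \<subseteq> X \<and> card e = 2}"

abbreviation star :: "'a set \<Rightarrow> 'a \<Rightarrow> 'a set set" where
  "star X x \<equiv> {e \<in> pairs X. x \<in> e}"

section \<open>Stars and small intersecting families of pairs\<close>

lemma star_eq_image:
  assumes "x \<in> X"
  shows "star X x = (\<lambda>y. {x, y}) ` (X - {x})"
  using assms by (auto simp: card_2_iff image_iff doubleton_eq_iff)

lemma inj_on_doubleton: "inj_on (\<lambda>y. {x, y}) (X - {x})"
  by (auto simp: inj_on_def doubleton_eq_iff)

lemma card_star: "x \<in> X \<Longrightarrow> card (star X x) = card X - 1"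
  by (simp only: star_eq_image card_image[OF inj_on_doubleton] card_Diff_singleton)

text \<open>Doubling turns all later counts into polynomial inequalities over the reals. For
  \<open>n = 0\<close> both sides vanish, although \<open>n - 1\<close> truncates in the natural
  numbers.\<close>

lemma two_real_choose_2: "2 * real (n choose 2) = real n * (real n - 1)"
proof -
  have "2 * (n choose 2) = n * (n - 1)"
    by (simp only: choose_two) (simp add: algebra_simps)
  then have "real (2 * (n choose 2)) = real (n * (n - 1))"
    by presburger
  then show ?thesis
    by (cases n) (auto simp: algebra_simps)
qed

text \<open>A pair avoiding \<open>x\<close> would have to contain all three of \<open>a\<close>,
  \<open>b\<close>, \<open>c\<close>.\<close>

lemma mem_if_meets_three:
  assumes "card e = 2" "e \<inter> {x, a} \<noteq> {}" "e \<inter> {x, b} \<noteq> {}" "e \<inter> {x, c} \<noteq> {}"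
    and "a \<noteq> b" "a \<noteq> c" "b \<noteq> c"
  shows "x \<in> e"
proof (rule ccontr)
  assume "x \<notin> e"
  then have "{a, b, c} \<subseteq> e"
    using assms by auto
  moreover have "finite e"
    using assms(1) card.infinite by fastforce
  ultimately have "card {a, b, c} \<le> card e"
    by (rule card_mono[rotated])
  then show False
    using assms by simp
qed

lemma pair_cases:
  assumes "card e = 2" "x \<in> e"
  obtains a where "e = {x, a}" "a \<noteq> x"
  using assms by (auto simp: card_2_iff)

text \<open>The first two pairs share a point \<open>x\<close>. If the third misses
  \<open>x\<close>, it must contain the other end of each, which closes a triangle.\<close>

lemma three_intersecting_pairs:
  assumes "card e1 = 2" "card e2 = 2" "card e3 = 2"
    and "e1 \<noteq> e2" "e1 \<noteq> e3" "e2 \<noteq> e3"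
    and "e1 \<inter> e2 \<noteq> {}" "e1 \<inter> e3 \<noteq> {}" "e2 \<inter> e3 \<noteq> {}"
  obtains (star) x a b c where "e1 = {x, a}" "e2 = {x, b}" "e3 = {x, c}"
      "distinct [x, a, b, c]"
    | (triangle) x a b where "e1 = {x, a}" "e2 = {x, b}" "e3 = {a, b}" "distinct [x, a, b]"
proof -
  obtain x where x: "x \<in> e1" "x \<in> e2"
    using assms by auto
  obtain a where a: "e1 = {x, a}" "a \<noteq> x"
    using assms x pair_cases by metis
  obtain b where b: "e2 = {x, b}" "b \<noteq> x"
    using assms x pair_cases by metis
  show thesis
  proof (cases "x \<in> e3")
    case True
    then obtain c where "e3 = {x, c}" "c \<noteq> x"
      using assms pair_cases by metis
    then show thesis
      using star[of x a b c] a b assms by auto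
  next
    case False
    then have "{a, b} \<subseteq> e3"
      using assms a b by auto
    moreover have "a \<noteq> b"
      using assms a b by auto
    moreover have "finite e3"
      using assms(3) card.infinite by fastforce
    ultimately have "e3 = {a, b}"
      using assms(3) by (metis card_2_iff card_subset_eq)
    then show thesis
      using triangle[of x a b] a b \<open>a \<noteq> b\<close> by auto
  qed
qed

text \<open>This keeps what matters about the components left after a deletion: \<open>meet\<close>
  is non-adjacency across parts, while nothing is demanded of two pairs in the same part.
  Intersecting families also fit, split into singletons.\<close>

locale cross_intersecting =
  fixes P :: "'a set set set"
  assumes nonempty: "A \<in> P \<Longrightarrow> A \<noteq> {}"
    and parts_disjoint: "A \<in> P \<Longrightarrow> B \<in> P \<Longrightarrow> A \<noteq> B \<Longrightarrow> A \<inter> B = {}"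
    and card_2: "A \<in> P \<Longrightarrow> e \<in> A \<Longrightarrow> card e = 2"
    and meet: "A \<in> P \<Longrightarrow> B \<in> P \<Longrightarrow> A \<noteq> B \<Longrightarrow> e \<in> A \<Longrightarrow> f \<in> B \<Longrightarrow> e \<inter> f \<noteq> {}"
begin

lemma representatives_neq:
  "A \<in> P \<Longrightarrow> B \<in> P \<Longrightarrow> A \<noteq> B \<Longrightarrow> e \<in> A \<Longrightarrow> f \<in> B \<Longrightarrow> e \<noteq> f"
  using parts_disjoint[of A B] by auto

lemma common_vertex:
  assumes "card P \<ge> 4"
  obtains x where "\<And>e. e \<in> \<Union>P \<Longrightarrow> x \<in> e"
proof -
  obtain Q where Q: "Q \<subseteq> P" "card Q = 4"
    using assms obtain_subset_with_card_n by metis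
  then obtain A1 A2 A3 A4 where QA: "Q = {A1, A2, A3, A4}" and "distinct [A1, A2, A3, A4]"
    by (auto simp: card_Suc_eq numeral_eq_Suc)
  then have A: "A1 \<in> P" "A2 \<in> P" "A3 \<in> P" "A4 \<in> P"
    "A1 \<noteq> A2" "A1 \<noteq> A3" "A1 \<noteq> A4" "A2 \<noteq> A3" "A2 \<noteq> A4" "A3 \<noteq> A4"
    using Q by auto
  obtain e1 e2 e3 e4 where e: "e1 \<in> A1" "e2 \<in> A2" "e3 \<in> A3" "e4 \<in> A4"
    using A(1-4)[THEN nonempty] by blast
  have c: "card e1 = 2" "card e2 = 2" "card e3 = 2" "card e4 = 2"
    by (rule A(1-4)[THEN card_2]; fact)+
  have m: "e1 \<inter> e2 \<noteq> {}" "e1 \<inter> e3 \<noteq> {}" "e1 \<inter> e4 \<noteq> {}" "e2 \<inter> e3 \<noteq> {}" "e2 \<inter> e4 \<noteq> {}"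
    "e3 \<inter> e4 \<noteq> {}"
    by (rule meet[OF A(1) A(2)] meet[OF A(1) A(3)] meet[OF A(1) A(4)] meet[OF A(2) A(3)]
        meet[OF A(2) A(4)] meet[OF A(3) A(4)]; fact)+
  have d: "e1 \<noteq> e2" "e1 \<noteq> e3" "e1 \<noteq> e4" "e2 \<noteq> e3" "e2 \<noteq> e4" "e3 \<noteq> e4"
    by (rule representatives_neq[OF A(1) A(2)] representatives_neq[OF A(1) A(3)]
        representatives_neq[OF A(1) A(4)] representatives_neq[OF A(2) A(3)]
        representatives_neq[OF A(2) A(4)] representatives_neq[OF A(3) A(4)]; fact)+
  have "\<exists>x. x \<in> e1 \<and> x \<in> e2 \<and> x \<in> e3 \<and> x \<in> e4"
    using c(1-3) d(1,2,4) m(1,2,4)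
  proof (cases rule: three_intersecting_pairs)
    case (star x a b c')
    have "x \<in> e4"
      by (rule mem_if_meets_three[of e4 x a b c']) (use star c m in \<open>auto simp: Int_commute\<close>)
    then show ?thesis
      using star by auto
  next
    \<comment> \<open>A pair meeting all three sides of a triangle contains two of its corners, so
      \<open>e4\<close> would be one of the sides.\<close>
    case (triangle x a b)
    obtain u w where uw: "e4 = {u, w}" "u \<noteq> w"
      using c by (auto simp: card_2_iff)
    then show ?thesis
      using triangle m d by auto
  qed
  then obtain x where x: "x \<in> e1" "x \<in> e2" "x \<in> e3" "x \<in> e4"
    by auto
  obtain a1 a2 a3 a4 where a: "e1 = {x, a1}" "e2 = {x, a2}" "e3 = {x, a3}" "e4 = {x, a4}"
    using x c pair_cases by metis
  have da: "a1 \<noteq> a2" "a1 \<noteq> a3" "a1 \<noteq> a4" "a2 \<noteq> a3" "a2 \<noteq> a4" "a3 \<noteq> a4"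
    using d a by auto
  show thesis
  proof
    fix e
    assume "e \<in> \<Union>P"
    then obtain A where AP: "A \<in> P" "e \<in> A"
      by auto
    have ce: "card e = 2"
      using AP card_2 by blast
    have mm: "A \<noteq> A1 \<Longrightarrow> e \<inter> {x, a1} \<noteq> {}" "A \<noteq> A2 \<Longrightarrow> e \<inter> {x, a2} \<noteq> {}"
      "A \<noteq> A3 \<Longrightarrow> e \<inter> {x, a3} \<noteq> {}" "A \<noteq> A4 \<Longrightarrow> e \<inter> {x, a4} \<noteq> {}"
      using meet[OF AP(1) A(1) _ AP(2) e(1)] meet[OF AP(1) A(2) _ AP(2) e(2)]
        meet[OF AP(1) A(3) _ AP(2) e(3)] meet[OF AP(1) A(4) _ AP(2) e(4)] a by simp_all
    \<comment> \<open>The part of \<open>e\<close> coincides with at most one of the four chosen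
      parts, so three representatives remain that \<open>e\<close> must meet.\<close>
    consider "A \<noteq> A1" "A \<noteq> A2" "A \<noteq> A3" | "A \<noteq> A1" "A \<noteq> A2" "A \<noteq> A4"
      | "A \<noteq> A1" "A \<noteq> A3" "A \<noteq> A4" | "A \<noteq> A2" "A \<noteq> A3" "A \<noteq> A4"
      using A by metis
    then show "x \<in> e"
    proof cases
      case 1
      then show ?thesis
        using mem_if_meets_three[OF ce mm(1) mm(2) mm(3)] da by blast
    next
      case 2
      then show ?thesis
        using mem_if_meets_three[OF ce mm(1) mm(2) mm(4)] da by blast
    next
      case 3
      then show ?thesis
        using mem_if_meets_three[OF ce mm(1) mm(3) mm(4)] da by blast
    next
      case 4
      then show ?thesis
        using mem_if_meets_three[OF ce mm(2) mm(3) mm(4)] da by blast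
    qed
  qed
qed

text \<open>Each pair lies outside two of the three parts and so meets two of the spokes
  \<open>{x, a}\<close>, \<open>{x, b}\<close>, \<open>{x, c}\<close>. If it avoids
  \<open>x\<close>, it joins two of \<open>a\<close>, \<open>b\<close>, \<open>c\<close>. This
  allows the star of \<open>x\<close> and three further pairs.\<close>

lemma card_Union_3_star:
  assumes P: "P = {A, B, C}" "A \<noteq> B" "A \<noteq> C" "B \<noteq> C" and X: "finite X" "\<Union>P \<subseteq> pairs X"
    and reps: "{x, a} \<in> A" "{x, b} \<in> B" "{x, c} \<in> C" and d: "distinct [x, a, b, c]"
  shows "card (\<Union>P) \<le> card X + 2"
proof -
  have x: "x \<in> X"
    using P(1) reps(1) X(2) by auto
  have ABC: "A \<in> P" "B \<in> P" "C \<in> P"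
    using P(1) by auto
  have "\<Union>P \<subseteq> star X x \<union> {{a, b}, {a, c}, {b, c}}"
  proof
    fix e
    assume e: "e \<in> \<Union>P"
    then have eX: "e \<in> pairs X"
      using X(2) by blast
    from e P(1) consider "e \<in> A" | "e \<in> B" | "e \<in> C"
      by auto
    then have "(e \<inter> {x, a} \<noteq> {} \<and> e \<inter> {x, b} \<noteq> {}) \<or> (e \<inter> {x, a} \<noteq> {} \<and> e \<inter> {x, c} \<noteq> {})
      \<or> (e \<inter> {x, b} \<noteq> {} \<and> e \<inter> {x, c} \<noteq> {})"
    proof cases
      case 1
      then show ?thesis
        using meet[OF ABC(1,2) P(2) _ reps(2)] meet[OF ABC(1,3) P(3) _ reps(3)] by simp
    next
      case 2
      then show ?thesis
        using meet[OF ABC(2,1) P(2)[symmetric] _ reps(1)] meet[OF ABC(2,3) P(4) _ reps(3)] by simp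
    next
      case 3
      then show ?thesis
        using meet[OF ABC(3,1) P(3)[symmetric] _ reps(1)]
          meet[OF ABC(3,2) P(4)[symmetric] _ reps(2)] by simp
    qed
    moreover obtain u w where "e = {u, w}"
      using eX by (auto simp: card_2_iff)
    ultimately have "x \<in> e \<or> e = {a, b} \<or> e = {a, c} \<or> e = {b, c}"
      using d by auto
    then show "e \<in> star X x \<union> {{a, b}, {a, c}, {b, c}}"
      using eX by blast
  qed
  then have "card (\<Union>P) \<le> card (star X x \<union> {{a, b}, {a, c}, {b, c}})"
    using X by (intro card_mono) auto
  also have "\<dots> \<le> card (star X x) + card {{a, b}, {a, c}, {b, c}}"
    by (rule card_Un_le)
  also have "\<dots> \<le> (card X - 1) + 3"
    unfolding card_star[OF x] by (simp add: card_insert_if)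
  also have "\<dots> = card X + 2"
    using x X by (cases "card X") auto
  finally show ?thesis .
qed

lemma card_Union_3:
  assumes P: "card P = 3" and X: "finite X" "\<Union>P \<subseteq> pairs X"
  shows "card (\<Union>P) \<le> card X + 2"
proof (rule ccontr)
  assume large: "\<not> card (\<Union>P) \<le> card X + 2"
  txt \<open>No choice of representatives is a star, so all are triangles. A triangle is determined by
    two of its sides, hence every part is a singleton.\<close>
  have tri: "e = (f - g) \<union> (g - f)"
    if ABC: "P = {A, B, C}" "A \<noteq> B" "A \<noteq> C" "B \<noteq> C" and reps: "e \<in> A" "f \<in> B" "g \<in> C"
    for A B C e f g
  proof -
    have P': "A \<in> P" "B \<in> P" "C \<in> P"
      using ABC(1) by auto
    show ?thesis
      using card_2[OF P'(1) reps(1)] card_2[OF P'(2) reps(2)] card_2[OF P'(3) reps(3)]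
        representatives_neq[OF P'(1,2) ABC(2) reps(1,2)]
        representatives_neq[OF P'(1,3) ABC(3) reps(1,3)]
        representatives_neq[OF P'(2,3) ABC(4) reps(2,3)]
        meet[OF P'(1,2) ABC(2) reps(1,2)] meet[OF P'(1,3) ABC(3) reps(1,3)]
        meet[OF P'(2,3) ABC(4) reps(2,3)]
    proof (cases rule: three_intersecting_pairs)
      case (star x a b c)
      then have False
        using card_Union_3_star[OF ABC X] reps large by metis
      then show ?thesis ..
    next
      case (triangle x a b)
      then show ?thesis
        by auto
    qed
  qed
  have singleton: "A = {e}"
    if ABC: "P = {A, B, C}" "A \<noteq> B" "A \<noteq> C" "B \<noteq> C" and "e \<in> A" for A B C e
  proof -
    have "B \<noteq> {}" "C \<noteq> {}"
      using ABC(1) by (auto dest: nonempty)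
    then obtain f g where fg: "f \<in> B" "g \<in> C"
      by blast
    have "e' = (f - g) \<union> (g - f)" if "e' \<in> A" for e'
      by (rule tri[OF ABC that fg])
    then show ?thesis
      using \<open>e \<in> A\<close> by blast
  qed
  obtain A B C where ABC: "P = {A, B, C}" "A \<noteq> B" "A \<noteq> C" "B \<noteq> C"
    using P by (auto simp: card_Suc_eq numeral_eq_Suc)
  have "A \<noteq> {}" "B \<noteq> {}" "C \<noteq> {}"
    using ABC(1) by (auto dest: nonempty)
  then obtain e f g where efg: "e \<in> A" "f \<in> B" "g \<in> C"
    by blast
  \<comment> \<open>Cyclic relabelling lets \<open>singleton\<close>, which speaks of the part named
    first, apply to each part in turn.\<close>
  have BCA: "P = {B, C, A}" "P = {C, A, B}"
    using ABC(1) by auto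
  have "A = {e}" "B = {f}" "C = {g}"
    using singleton[OF ABC efg(1)]
      singleton[OF BCA(1) ABC(4) ABC(2,3)[symmetric] efg(2)]
      singleton[OF BCA(2) ABC(3,4)[symmetric] ABC(2) efg(3)] by auto
  then have U: "\<Union>P = {e, f, g}"
    using ABC(1) by auto
  have "card {e, f, g} \<le> 3"
    by (simp add: card_insert_if)
  moreover have "card X > 0"
    using U X by (auto simp: card_gt_0_iff)
  ultimately show False
    using large unfolding U by linarith
qed

text \<open>The left-hand binomial counts the pairs avoiding three points \<open>x\<close>,
  \<open>a\<close>, \<open>b\<close>, all of which are missing from the union. The two further
  missing pairs decide the case of six points: there the binomial is only 3, while the toughness
  bound asks for 4.\<close>

lemma card_Union_2:
  assumes P: "card P = 2" and X: "finite X" "\<Union>P \<subseteq> pairs X" and v: "card X \<ge> 6"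
  shows "card (\<Union>P) + ((card X - 3) choose 2) + 2 \<le> card X choose 2"
proof -
  obtain A B where AB: "P = {A, B}" "A \<noteq> B"
    using P by (auto simp: card_2_iff)
  then have P': "A \<in> P" "B \<in> P"
    by auto
  then obtain e f where ef: "e \<in> A" "f \<in> B"
    using nonempty by blast
  have "card e = 2" "card f = 2" "e \<noteq> f" "e \<inter> f \<noteq> {}"
    using card_2[OF P'(1) ef(1)] card_2[OF P'(2) ef(2)] representatives_neq[OF P' AB(2) ef]
      meet[OF P' AB(2) ef] by auto
  moreover from this obtain x where "x \<in> e" "x \<in> f"
    by auto
  ultimately obtain a b where ab: "e = {x, a}" "f = {x, b}" "distinct [x, a, b]"
    using pair_cases by (metis distinct_length_2_or_more distinct_singleton)
  have eX: "x \<in> X" "a \<in> X" "b \<in> X"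
    using ab ef AB X by auto
  let ?Y = "X - {x, a, b}"
  have cY: "card ?Y = card X - 3"
    using eX ab X by (subst card_Diff_subset) auto
  then have "card ?Y \<ge> 2"
    using v by simp
  then obtain Z where "Z \<subseteq> ?Y" "card Z = 2"
    using obtain_subset_with_card_n by metis
  then obtain p q where pq: "p \<in> ?Y" "q \<in> ?Y" "p \<noteq> q"
    by (auto simp: card_2_iff)
  have inB: "g \<in> B" if "g \<in> \<Union>P" "g \<inter> f = {}" for g
    using that AB(1) meet[OF P' AB(2) _ ef(2)] by auto
  have inA: "g \<in> A" if "g \<in> \<Union>P" "g \<inter> e = {}" for g
    using that AB(1) meet[OF P' AB(2) ef(1)] by auto
  txt \<open>Outside \<open>{x, a, b}\<close> no pair survives, and neither can both of \<open>{a, p}\<close>, \<open>{b, q}\<close> nor both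
    of \<open>{a, q}\<close>, \<open>{b, p}\<close>: disjointness from \<open>f\<close> or \<open>e\<close> would put them into different parts.\<close>
  have no: "\<not> (g \<in> \<Union>P \<and> h \<in> \<Union>P)" if "g \<inter> f = {}" "h \<inter> e = {}" "g \<inter> h = {}" for g h
    using inB[of g] inA[of h] meet[OF P' AB(2), of h g] that by auto
  obtain s where s: "s \<in> {{a, p}, {b, q}}" "s \<notin> \<Union>P"
    using no[of "{a, p}" "{b, q}"] ab pq by auto
  obtain t where t: "t \<in> {{a, q}, {b, p}}" "t \<notin> \<Union>P"
    using no[of "{a, q}" "{b, p}"] ab pq by auto
  have Y: "pairs ?Y \<inter> \<Union>P = {}"
  proof (rule ccontr)
    assume "pairs ?Y \<inter> \<Union>P \<noteq> {}"
    then obtain g where g: "g \<in> \<Union>P" "g \<subseteq> ?Y"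
      by auto
    then have "g \<in> A" "g \<in> B"
      using inA inB ab by auto
    then show False
      using parts_disjoint[OF P' AB(2)] by auto
  qed
  have st: "s \<noteq> t" "s \<notin> pairs ?Y" "t \<notin> pairs ?Y" "s \<in> pairs X" "t \<in> pairs X"
    using s(1) t(1) ab(3) pq eX by (auto simp: doubleton_eq_iff card_insert_if)
  have fin: "finite (pairs X)" "finite (pairs ?Y)" "finite (\<Union>P)"
    using X finite_subset[OF X(2)] by auto
  have "card (pairs X) \<ge> card (\<Union>P \<union> (pairs ?Y \<union> {s, t}))"
    by (rule card_mono) (use fin X(2) st(4,5) in blast)+
  also have "card (\<Union>P \<union> (pairs ?Y \<union> {s, t})) = card (\<Union>P) + card (pairs ?Y \<union> {s, t})"
    by (rule card_Un_disjoint) (use fin Y s(2) t(2) in blast)+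
  also have "card (pairs ?Y \<union> {s, t}) = card (pairs ?Y) + card {s, t}"
    by (rule card_Un_disjoint) (use fin st in blast)+
  also have "card {s, t} = 2"
    using st(1) by simp
  finally show ?thesis
    using X n_subsets[of X 2] n_subsets[of ?Y 2] cY by simp
qed

end

section \<open>Lower bound for the number of deleted pairs\<close>

lemma (in cross_intersecting) card_le_card_Union:
  assumes "finite (\<Union>P)"
  shows "card P \<le> card (\<Union>P)"
proof -
  have fin: "finite P" "\<And>A. A \<in> P \<Longrightarrow> finite A"
    using assms finite_UnionD by (blast, meson Union_upper finite_subset)
  have "card P = (\<Sum>A\<in>P. 1)"
    by simp
  also have "\<dots> \<le> (\<Sum>A\<in>P. card A)"
    using fin nonempty by (intro sum_mono) (simp add: Suc_leI card_gt_0_iff)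
  also have "\<dots> = card (\<Union>P)"
    using fin parts_disjoint by (intro card_Union_disjoint[symmetric]) (auto simp: pairwise_def disjnt_def)
  finally show ?thesis .
qed

lemma card_pairs: "finite X \<Longrightarrow> card (pairs X) = card X choose 2"
  by (rule n_subsets)

text \<open>With the parts as components, \<open>pairs X\<close> minus their union is the deleted
  set. The inequality is strict for two or three parts, so equality can occur only inside a
  star.\<close>

proposition (in cross_intersecting) toughness_bound:
  assumes X: "finite X" "card X \<ge> 6" "\<Union>P \<subseteq> pairs X" and P: "card P \<ge> 2"
  shows "real (card P) * (real (card X) / 2 - 1) \<le> real (card (pairs X - \<Union>P))" (is ?bound)
    and "real (card P) * (real (card X) / 2 - 1) = real (card (pairs X - \<Union>P)) \<Longrightarrow>
      \<exists>x\<in>X. \<Union>P = star X x"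
proof -
  define v c h where vch: "v = real (card X)" "c = real (card P)" "h = real (card (\<Union>P))"
  have v: "v \<ge> 6"
    using X(2) by (simp add: vch)
  have finU: "finite (\<Union>P)"
    by (rule finite_subset[OF X(3)]) (simp add: X(1))
  have "card (pairs X - \<Union>P) = card (pairs X) - card (\<Union>P)"
    using finU X(3) by (rule card_Diff_subset)
  moreover have "card (\<Union>P) \<le> card (pairs X)"
    using X(1) by (intro card_mono X(3)) simp
  ultimately have rest: "2 * real (card (pairs X - \<Union>P)) = v * (v - 1) - 2 * h"
    using two_real_choose_2[of "card X"] card_pairs[OF X(1)] by (simp add: vch of_nat_diff)
  have "?bound \<and> (c * (v / 2 - 1) = real (card (pairs X - \<Union>P)) \<longrightarrow> (\<exists>x\<in>X. \<Union>P = star X x))"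
  proof -
    consider "card P = 2" | "card P = 3" | "card P \<ge> 4"
      using P by linarith
    then show ?thesis
    proof cases
      case 1
      have "real (card (\<Union>P) + ((card X - 3) choose 2) + 2) \<le> real (card X choose 2)"
        using card_Union_2[OF 1 X(1,3,2)] by (rule of_nat_mono)
      then have "2 * h + (v - 3) * (v - 4) + 4 \<le> v * (v - 1)"
        using two_real_choose_2[of "card X"] two_real_choose_2[of "card X - 3"] X(2)
        by (simp add: vch of_nat_diff)
      then have "2 * real (card (pairs X - \<Union>P)) \<ge> (v - 3) * (v - 4) + 4"
        using rest by linarith
      moreover have "(v - 5) * (v - 4) > 0"
        using v by simp
      \<comment> \<open>The difference of the two sides is exactly
        \<open>(v - 5) * (v - 4)\<close>.\<close>
      then have "(v - 3) * (v - 4) + 4 > 2 * (v - 2)"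
        by (simp add: algebra_simps)
      moreover have "c = 2"
        using 1 by (simp add: vch)
      ultimately have "c * (v / 2 - 1) < real (card (pairs X - \<Union>P))"
        by (simp add: algebra_simps)
      then show ?thesis
        by (simp add: vch)
    next
      case 2
      have "h \<le> v + 2"
        using of_nat_mono[OF card_Union_3[OF 2 X(1,3)], where ?'a = real] by (simp add: vch)
      then have "2 * real (card (pairs X - \<Union>P)) \<ge> v * (v - 1) - 2 * (v + 2)"
        unfolding rest by simp
      \<comment> \<open>The inequality below has difference \<open>v * (v - 6) + 2\<close>.\<close>
      moreover have "v * (v - 6) \<ge> 0"
        using v by simp
      then have "v * (v - 1) - 2 * (v + 2) > 3 * (v - 2)"
        by (simp add: algebra_simps)
      moreover have "c = 3"
        using 2 by (simp add: vch)
      ultimately have "c * (v / 2 - 1) < real (card (pairs X - \<Union>P))"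
        by (simp add: algebra_simps)
      then show ?thesis
        by (simp add: vch)
    next
      case 3
      then obtain x where x: "\<And>e. e \<in> \<Union>P \<Longrightarrow> x \<in> e"
        by (rule common_vertex) blast
      have sub: "\<Union>P \<subseteq> star X x"
        using x X(3) by blast
      have "P \<noteq> {}"
        using P by auto
      then have "\<Union>P \<noteq> {}"
        using nonempty by blast
      then have xX: "x \<in> X"
        using sub by blast
      have fin_star: "finite (star X x)"
        using X(1) by simp
      have card_star': "real (card (star X x)) = v - 1"
        using card_star[OF xX] X(2) by (simp add: vch of_nat_diff)
      have h: "h \<le> v - 1"
        using card_mono[OF fin_star sub] card_star' by (simp add: vch)
      moreover have ch: "c \<le> h"
        using card_le_card_Union[OF finU] by (simp add: vch)
      ultimately have "c \<le> v - 1"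
        by linarith
      then have "c * (v - 2) \<le> (v - 1) * (v - 2)"
        using v by (intro mult_right_mono) auto
      moreover have "(v - 1) * (v - 2) \<le> 2 * real (card (pairs X - \<Union>P))"
        unfolding rest using h by (simp add: algebra_simps)
      ultimately have bound: ?bound
        by (simp add: vch algebra_simps)
      have "\<Union>P = star X x" if eq: "c * (v / 2 - 1) = real (card (pairs X - \<Union>P))"
      proof -
        \<comment> \<open>Equality ties the slack in \<open>h \<le> v - 1\<close> to the slack in
          \<open>c \<le> v - 1\<close> with opposite sign. Neither is negative, so the union fills
          the star.\<close>
        have "2 * (v - 1 - h) = - ((v - 1 - c) * (v - 2))"
          using eq rest by (simp add: algebra_simps)
        also have "\<dots> \<le> 0"
          using \<open>c \<le> v - 1\<close> v by simp
        finally have "v - 1 \<le> h"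
          by simp
        with h have "h = v - 1"
          by (rule antisym)
        then have "card (\<Union>P) = card (star X x)"
          using card_star' by (simp add: vch)
        then show ?thesis
          by (rule card_subset_eq[OF fin_star sub])
      qed
      then show ?thesis
        using bound xX by blast
    qed
  qed
  then show ?bound
    and "real (card P) * (real (card X) / 2 - 1) = real (card (pairs X - \<Union>P)) \<Longrightarrow>
      \<exists>x\<in>X. \<Union>P = star X x"
    by (simp_all only: vch)
qed

section \<open>The spectrum\<close>

abbreviation Tbar :: "'a set \<Rightarrow> ('a set, 'a set \<times> 'a set) pre_digraph" where
  "Tbar X \<equiv> with_proj (complement_graph (triangular_graph X))"

lemma verts_Tbar: "verts (Tbar X) = pairs X"
  by (simp add: pverts_complement_triangular_graph)

lemma dominates_Tbar: "e \<rightarrow>\<^bsub>Tbar X\<^esub> f \<longleftrightarrow> e \<in> pairs X \<and> f \<in> pairs X \<and> e \<inter> f = {}"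
  by (auto simp: parcs_complement_triangular_graph)

text \<open>Passing from vectors indexed by positions to functions on vertices removes the
  enumeration \<open>vs\<close> from the spectral argument. Distinctness makes positions and
  vertices correspond one to one.\<close>

lemma eigenvalue_adjacency_matrix:
  assumes "distinct vs"
  shows "eigenvalue (adjacency_matrix G vs) l \<longleftrightarrow>
    (\<exists>y. (\<exists>e\<in>set vs. y e \<noteq> 0) \<and>
         (\<forall>e\<in>set vs. (\<Sum>f | f \<in> set vs \<and> e \<rightarrow>\<^bsub>G\<^esub> f. y f) = l * y e))"
    (is "_ \<longleftrightarrow> (\<exists>y. ?E y)")
proof -
  let ?n = "length vs" and ?A = "adjacency_matrix G vs"
  have bij: "bij_betw ((!) vs) {0..<?n} (set vs)"
    using bij_betw_nth[OF assms] by (simp add: atLeast0LessThan)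
  have product: "(?A *\<^sub>v x) $ i = (\<Sum>f | f \<in> set vs \<and> vs ! i \<rightarrow>\<^bsub>G\<^esub> f. y f)"
    if "dim_vec x = ?n" "i < ?n" "\<And>j. j < ?n \<Longrightarrow> x $ j = y (vs ! j)" for x y i
  proof -
    have "(?A *\<^sub>v x) $ i = (\<Sum>j\<in>{0..<?n}. (if vs ! i \<rightarrow>\<^bsub>G\<^esub> vs ! j then y (vs ! j) else 0))"
      using that by (auto simp: adjacency_matrix_def scalar_prod_def intro!: sum.cong)
    also have "\<dots> = (\<Sum>f\<in>set vs. if vs ! i \<rightarrow>\<^bsub>G\<^esub> f then y f else 0)"
      by (rule sum.reindex_bij_betw[OF bij])
    finally show ?thesis
      by (simp add: sum.inter_filter)
  qed
  \<comment> \<open>Stated for any vector and function that agree along \<open>vs\<close>, so that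
    one equivalence serves both directions.\<close>
  have vec: "eigenvector ?A x l \<longleftrightarrow> ?E y"
    if "dim_vec x = ?n" "\<And>j. j < ?n \<Longrightarrow> x $ j = y (vs ! j)" for x y
  proof -
    have dim: "dim_row ?A = ?n"
      by (simp add: adjacency_matrix_def)
    have "x \<noteq> 0\<^sub>v ?n \<longleftrightarrow> (\<exists>j<?n. y (vs ! j) \<noteq> 0)"
      using that by (auto simp: vec_eq_iff)
    then have "x \<noteq> 0\<^sub>v ?n \<longleftrightarrow> (\<exists>e\<in>set vs. y e \<noteq> 0)"
      by (simp add: set_conv_nth) blast
    moreover have "?A *\<^sub>v x = l \<cdot>\<^sub>v x \<longleftrightarrow>
        (\<forall>i<?n. (\<Sum>f | f \<in> set vs \<and> vs ! i \<rightarrow>\<^bsub>G\<^esub> f. y f) = l * y (vs ! i))"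
      unfolding vec_eq_iff index_smult_vec dim_mult_mat_vec dim that(1)
      using product[OF that(1) _ that(2)] that(2) by (auto simp: that(1))
    then have "?A *\<^sub>v x = l \<cdot>\<^sub>v x \<longleftrightarrow>
        (\<forall>e\<in>set vs. (\<Sum>f | f \<in> set vs \<and> e \<rightarrow>\<^bsub>G\<^esub> f. y f) = l * y e)"
      unfolding all_set_conv_all_nth .
    moreover have "x \<in> carrier_vec ?n"
      using that(1) by (rule carrier_vecI)
    ultimately show ?thesis
      unfolding eigenvector_def dim by blast
  qed
  show ?thesis
  proof
    assume "eigenvalue ?A l"
    then obtain x where x: "eigenvector ?A x l"
      by (auto simp: eigenvalue_def)
    then have "dim_vec x = ?n"
      by (auto simp: eigenvector_def adjacency_matrix_def)
    \<comment> \<open>The function on vertices looks up the position of a vertex through the inverse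
      of the indexing map.\<close>
    moreover have "x $ j = x $ (inv_into {0..<?n} ((!) vs) (vs ! j))" if "j < ?n" for j
      using that bij by (simp add: bij_betw_def)
    ultimately have "eigenvector ?A x l \<longleftrightarrow> ?E (\<lambda>e. x $ (inv_into {0..<?n} ((!) vs) e))"
      by (rule vec)
    then show "\<exists>y. ?E y"
      by (intro exI, rule iffD1) (rule x)
  next
    assume "\<exists>y. ?E y"
    then obtain y where "?E y" ..
    moreover have "eigenvector ?A (Matrix.vec ?n (\<lambda>j. y (vs ! j))) l \<longleftrightarrow> ?E y"
      by (rule vec) simp_all
    ultimately have "eigenvector ?A (Matrix.vec ?n (\<lambda>j. y (vs ! j))) l"
      by (rule iffD2[rotated])
    then show "eigenvalue ?A l"
      unfolding eigenvalue_def ..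
  qed
qed

text \<open>Finiteness of the spectrum is what makes the \<open>Min\<close> in the definition a true
  minimum.\<close>

lemma smallest_eigenvalue_eqI:
  assumes "A \<in> carrier_mat n n" "eigenvalue A l" "\<And>m. eigenvalue A m \<Longrightarrow> l \<le> m"
  shows "smallest_eigenvalue A = l"
  unfolding smallest_eigenvalue_def
proof (rule Min_eqI)
  show "finite {l. eigenvalue A l}"
    using card_finite_spectrum(1)[OF assms(1)] by (simp add: spectrum_def)
qed (use assms in auto)

section \<open>Star sums and the eigenvalues of disjointness\<close>

lemma sum_star:
  fixes y :: "'a set \<Rightarrow> real"
  assumes "i \<in> X"
  shows "(\<Sum>f\<in>star X i. y f) = (\<Sum>j\<in>X - {i}. y {i, j})"
  using sum.reindex[OF inj_on_doubleton, of y i X] star_eq_image[OF assms] by simp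

lemma real_card_Diff_singleton:
  assumes "finite X" "i \<in> X"
  shows "real (card (X - {i})) = real (card X) - 1"
  using card_Suc_Diff1[OF assms] by (simp flip: of_nat_Suc)

text \<open>Double counting: every pair lies in the stars of its two points.\<close>

lemma sum_sum_star:
  fixes y :: "'a set \<Rightarrow> real"
  assumes "finite X"
  shows "(\<Sum>i\<in>X. \<Sum>f\<in>star X i. y f) = 2 * (\<Sum>f\<in>pairs X. y f)"
proof -
  have "(\<Sum>i\<in>X. \<Sum>f\<in>star X i. y f) = (\<Sum>i\<in>X. \<Sum>f\<in>pairs X. if i \<in> f then y f else 0)"
    using assms by (intro sum.cong refl sum.inter_filter) auto
  also have "\<dots> = (\<Sum>f\<in>pairs X. \<Sum>i\<in>X. if i \<in> f then y f else 0)"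
    by (rule sum.swap)
  also have "\<dots> = (\<Sum>f\<in>pairs X. 2 * y f)"
  proof (rule sum.cong)
    fix f
    assume "f \<in> pairs X"
    then have "{i \<in> X. i \<in> f} = f" "card f = 2"
      by auto
    moreover have "(\<Sum>i\<in>X. if i \<in> f then y f else 0) = (\<Sum>i\<in>{i \<in> X. i \<in> f}. y f)"
      using assms by (rule sum.inter_filter[symmetric])
    ultimately show "(\<Sum>i\<in>X. if i \<in> f then y f else 0) = 2 * y f"
      by simp
  qed simp
  finally show ?thesis
    by (simp add: sum_distrib_left)
qed

text \<open>Inclusion-exclusion: \<open>{i, j}\<close> is the only pair lying in both stars, so it
  alone has been subtracted twice.\<close>

lemma sum_disjoint_pairs:
  fixes y :: "'a set \<Rightarrow> real"
  assumes X: "finite X" and ij: "i \<in> X" "j \<in> X" "i \<noteq> j"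
  shows "(\<Sum>f | f \<in> pairs X \<and> {i, j} \<inter> f = {}. y f) =
    (\<Sum>f\<in>pairs X. y f) - (\<Sum>f\<in>star X i. y f) - (\<Sum>f\<in>star X j. y f) + y {i, j}"
proof -
  have fin: "finite (pairs X)"
    using X by simp
  have "(\<Sum>f | f \<in> pairs X \<and> {i, j} \<inter> f = {}. y f) =
      (\<Sum>f\<in>pairs X. if {i, j} \<inter> f = {} then y f else 0)"
    using fin by (rule sum.inter_filter)
  also have "\<dots> = (\<Sum>f\<in>pairs X. y f - (if i \<in> f then y f else 0) - (if j \<in> f then y f else 0)
      + (if f = {i, j} then y f else 0))"
  proof (rule sum.cong)
    fix f
    assume "f \<in> pairs X"
    then have "f = {i, j} \<longleftrightarrow> i \<in> f \<and> j \<in> f"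
      using ij by (auto simp: card_2_iff)
    then show "(if {i, j} \<inter> f = {} then y f else 0) = y f - (if i \<in> f then y f else 0)
        - (if j \<in> f then y f else 0) + (if f = {i, j} then y f else 0)"
      by auto
  qed simp
  also have "\<dots> = (\<Sum>f\<in>pairs X. y f) - (\<Sum>f\<in>pairs X. if i \<in> f then y f else 0)
      - (\<Sum>f\<in>pairs X. if j \<in> f then y f else 0) + (\<Sum>f\<in>pairs X. if f = {i, j} then y f else 0)"
    by (simp only: sum.distrib sum_subtractf)
  also have "(\<Sum>f\<in>pairs X. if f = {i, j} then y f else 0) = y {i, j}"
    using fin ij by (subst sum.delta) auto
  also have "(\<Sum>f\<in>pairs X. if i \<in> f then y f else 0) = (\<Sum>f\<in>star X i. y f)"
    using fin by (rule sum.inter_filter[symmetric])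
  also have "(\<Sum>f\<in>pairs X. if j \<in> f then y f else 0) = (\<Sum>f\<in>star X j. y f)"
    using fin by (rule sum.inter_filter[symmetric])
  finally show ?thesis .
qed

text \<open>A nonzero total \<open>s\<close> forces the degree. If \<open>s = 0\<close>, then either
  \<open>l = - (v - 3)\<close> or all star sums \<open>d i\<close> vanish, and the pair equation
  forces \<open>l = 1\<close>.\<close>

lemma disjointness_eigenvalue_cases:
  fixes y :: "'a set \<Rightarrow> real"
  assumes X: "finite X" "card X \<ge> 3"
    and eq: "\<And>e. e \<in> pairs X \<Longrightarrow> (\<Sum>f | f \<in> pairs X \<and> e \<inter> f = {}. y f) = l * y e"
    and nz: "e0 \<in> pairs X" "y e0 \<noteq> 0"
  shows "l = real ((card X - 2) choose 2) \<or> l = 1 \<or> l = - (real (card X) - 3)"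
proof -
  define v where "v = real (card X)"
  define s where "s = (\<Sum>f\<in>pairs X. y f)"
  define d where "d i = (\<Sum>f\<in>star X i. y f)" for i
  have pair_eq: "(l - 1) * y {i, j} = s - d i - d j" if "i \<in> X" "j \<in> X" "i \<noteq> j" for i j
  proof -
    have "{i, j} \<in> pairs X"
      using that by simp
    from eq[OF this] have "l * y {i, j} = s - d i - d j + y {i, j}"
      unfolding sum_disjoint_pairs[OF X(1) that] s_def d_def by (rule sym)
    then show ?thesis
      by (simp add: algebra_simps)
  qed
  have sum_d: "(\<Sum>j\<in>X. d j) = 2 * s"
    using sum_sum_star[OF X(1), of y] by (simp add: s_def d_def)
  \<comment> \<open>Sum \<open>pair_eq\<close> over the \<open>v - 1\<close> pairs through
    \<open>i\<close>. The \<open>d j\<close> with \<open>j \<noteq> i\<close> add up to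
    \<open>2 * s - d i\<close>.\<close>
  have d_eq: "(l + v - 3) * d i = (v - 3) * s" if i: "i \<in> X" for i
  proof -
    have "(l - 1) * d i = (\<Sum>j\<in>X - {i}. (l - 1) * y {i, j})"
      using sum_star[OF i, of y] by (simp add: d_def sum_distrib_left)
    also have "\<dots> = (\<Sum>j\<in>X - {i}. (s - d i) - d j)"
      using pair_eq i by (intro sum.cong) auto
    also have "\<dots> = (v - 1) * (s - d i) - (2 * s - d i)"
      using real_card_Diff_singleton[OF X(1) i] sum_d sum_diff1[OF X(1), of d i] i
      by (simp only: sum_subtractf sum_constant v_def if_True) (simp add: algebra_simps)
    finally show ?thesis
      by (simp add: algebra_simps)
  qed
  show ?thesis
  proof (cases "s = 0")
    case False
    \<comment> \<open>Summing \<open>d_eq\<close> over all points leaves an equation in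
      \<open>s\<close> alone, from which \<open>s\<close> cancels.\<close>
    have "(l + v - 3) * (2 * s) = (\<Sum>i\<in>X. (l + v - 3) * d i)"
      by (simp only: sum_d[symmetric] sum_distrib_left)
    also have "\<dots> = v * ((v - 3) * s)"
      using d_eq by (simp add: v_def)
    finally have "(2 * l - (v - 2) * (v - 3)) * s = 0"
      by (simp add: algebra_simps)
    then have "2 * l = (v - 2) * (v - 3)"
      using False by simp
    also have "\<dots> = 2 * real ((card X - 2) choose 2)"
      using X by (simp add: two_real_choose_2 of_nat_diff v_def)
    finally show ?thesis
      by simp
  next
    case s: True
    show ?thesis
    proof (cases "l + v - 3 = 0")
      case True
      then show ?thesis
        by (simp add: v_def)
    next
      case False
      then have "d i = 0" if "i \<in> X" for i
        using d_eq[OF that] s by simp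
      moreover obtain i j where "e0 = {i, j}" "i \<noteq> j"
        using nz by (auto simp: card_2_iff)
      ultimately have "(l - 1) * y e0 = 0"
        using pair_eq[of i j] s nz by simp
      then show ?thesis
        using nz by simp
    qed
  qed
qed

text \<open>This realises the negative candidate. The function sending \<open>{i, j}\<close> to
  \<open>u i + u j\<close> has star sums \<open>(v - 2) * u i\<close>, where \<open>v\<close> is the
  size of \<open>X\<close>, and total 0. Inclusion-exclusion then gives the factor
  \<open>1 - (v - 2)\<close>.\<close>

lemma disjointness_eigenvector:
  fixes u :: "'a \<Rightarrow> real"
  assumes X: "finite X" and u: "(\<Sum>i\<in>X. u i) = 0" and e: "e \<in> pairs X"
  shows "(\<Sum>f | f \<in> pairs X \<and> e \<inter> f = {}. sum u f) = - (real (card X) - 3) * sum u e"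
proof -
  obtain i j where ij: "e = {i, j}" "i \<noteq> j" "i \<in> X" "j \<in> X"
    using e by (auto simp: card_2_iff)
  have d: "(\<Sum>f\<in>star X i. sum u f) = (real (card X) - 2) * u i" if i: "i \<in> X" for i
  proof -
    have "(\<Sum>f\<in>star X i. sum u f) = (\<Sum>j\<in>X - {i}. u i + u j)"
      unfolding sum_star[OF i] by (intro sum.cong) auto
    also have "\<dots> = (real (card X) - 1) * u i - u i"
      using real_card_Diff_singleton[OF X i] u sum_diff1[OF X, of u i] i
      by (simp only: sum.distrib sum_constant if_True)
    finally show ?thesis
      by (simp add: algebra_simps)
  qed
  have "2 * (\<Sum>f\<in>pairs X. sum u f) = (\<Sum>i\<in>X. (real (card X) - 2) * u i)"
    using sum_sum_star[OF X, of "sum u"] d by simp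
  then have "(\<Sum>f\<in>pairs X. sum u f) = 0"
    using u by (simp flip: sum_distrib_left)
  then show ?thesis
    unfolding ij(1) sum_disjoint_pairs[OF X ij(3,4,2)] d[OF ij(3)] d[OF ij(4)]
    using ij(2) by (simp add: algebra_simps)
qed

lemma smallest_eigenvalue_Tbar:
  assumes X: "finite X" "card X \<ge> 3" and vs: "distinct vs" "set vs = pairs X"
  shows "smallest_eigenvalue (adjacency_matrix (Tbar X) vs) = - (real (card X) - 3)"
proof (rule smallest_eigenvalue_eqI)
  let ?A = "adjacency_matrix (Tbar X) vs"
  have nbrs: "{f. f \<in> set vs \<and> e \<rightarrow>\<^bsub>Tbar X\<^esub> f} = {f. f \<in> pairs X \<and> e \<inter> f = {}}"
    if "e \<in> pairs X" for e
    using that vs by (auto simp only: dominates_Tbar)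
  have ev: "eigenvalue ?A l \<longleftrightarrow> (\<exists>y. (\<exists>e\<in>pairs X. y e \<noteq> 0) \<and>
      (\<forall>e\<in>pairs X. (\<Sum>f | f \<in> pairs X \<and> e \<inter> f = {}. y f) = l * y e))" for l
    unfolding eigenvalue_adjacency_matrix[OF vs(1)] using nbrs vs(2) by simp
  show "?A \<in> carrier_mat (length vs) (length vs)"
    by (simp add: adjacency_matrix_def)
  show "eigenvalue ?A (- (real (card X) - 3))"
  proof -
    obtain Z where "Z \<subseteq> X" "card Z = 3"
      using X obtain_subset_with_card_n by metis
    then obtain a b c where abc: "{a, b, c} \<subseteq> X" "a \<noteq> b" "a \<noteq> c" "b \<noteq> c"
      by (auto simp: card_Suc_eq numeral_eq_Suc)
    \<comment> \<open>A zero-sum weight. The third point \<open>c\<close> is needed because the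
      weights cancel on \<open>{a, b}\<close>, whereas \<open>{a, c}\<close> receives 1.\<close>
    define u :: "'a \<Rightarrow> real" where "u i = (if i = a then 1 else 0) - (if i = b then 1 else 0)" for i
    have "(\<Sum>i\<in>X. u i) = 0"
      using X abc by (simp add: u_def sum_subtractf)
    moreover have "{a, c} \<in> pairs X" "sum u {a, c} \<noteq> 0"
      using abc by (auto simp: u_def)
    ultimately show ?thesis
      unfolding ev using disjointness_eigenvector[OF X(1)] by blast
  qed
  show "- (real (card X) - 3) \<le> l" if "eigenvalue ?A l" for l
  proof -
    from that obtain y e0 where y: "e0 \<in> pairs X" "y e0 \<noteq> 0"
      "\<And>e. e \<in> pairs X \<Longrightarrow> (\<Sum>f | f \<in> pairs X \<and> e \<inter> f = {}. y f) = l * y e"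
      unfolding ev by blast
    have "l = real ((card X - 2) choose 2) \<or> l = 1 \<or> l = - (real (card X) - 3)"
      by (rule disjointness_eigenvalue_cases[where y = y and ?e0.0 = e0])
        (use X y in \<open>simp_all only: not_False_eq_True\<close>)
    moreover have "3 \<le> real (card X)"
      using X(2) by simp
    ultimately show ?thesis
      by fastforce
  qed
qed

section \<open>Components and toughness\<close>

lemma dominates_induce_subgraph:
  "u \<rightarrow>\<^bsub>G \<restriction> W\<^esub> w \<longleftrightarrow> u \<rightarrow>\<^bsub>G\<^esub> w \<and> u \<in> W \<and> w \<in> W"
  unfolding arcs_ends_def arc_to_ends_def by auto

lemma Union_sccs_verts:
  assumes "wf_digraph D"
  shows "\<Union>(pre_digraph.sccs_verts D) = verts D"
proof -
  interpret wf_digraph D by fact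
  show ?thesis
    using in_scc_of_self sccs_verts_subsets unfolding sccs_verts_conv_scc_of by blast
qed

lemma sccs_verts_arcless:
  assumes D: "wf_digraph D" "\<And>u w. \<not> u \<rightarrow>\<^bsub>D\<^esub> w"
  shows "pre_digraph.sccs_verts D = (\<lambda>u. {u}) ` verts D"
proof -
  interpret wf_digraph D by fact
  have "u = w" if "u \<rightarrow>\<^sup>*\<^bsub>D\<^esub> w" for u w
    using that by induct (use D(2) in auto)
  then have "scc_of u = {u}" if "u \<in> verts D" for u
    using that by (auto simp: scc_of_def)
  then show ?thesis
    unfolding sccs_verts_conv_scc_of by simp
qed

lemma wf_digraph_Tbar:
  assumes "finite X"
  shows "wf_digraph (Tbar X)"
proof -
  interpret pair_graph "complement_graph (triangular_graph X)"
    using assms by (rule pair_graph_complement_triangular_graph)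
  show ?thesis
    by unfold_locales
qed

context
  fixes X :: "'a set"
  assumes X: "finite X"
begin

lemma wf_del_verts_Tbar: "wf_digraph (del_verts (Tbar X) S)"
  unfolding del_verts_def using wf_digraph.wellformed_induce_subgraph[OF wf_digraph_Tbar[OF X]] .

lemma verts_del_verts_Tbar: "verts (del_verts (Tbar X) S) = pairs X - S"
  by (simp add: del_verts_def pverts_complement_triangular_graph)

lemma dominates_del_verts_Tbar:
  "e \<rightarrow>\<^bsub>del_verts (Tbar X) S\<^esub> f \<longleftrightarrow> e \<in> pairs X - S \<and> f \<in> pairs X - S \<and> e \<inter> f = {}"
  unfolding del_verts_def dominates_induce_subgraph dominates_Tbar verts_Tbar by blast

text \<open>\<open>num_components\<close> counts components as subgraphs; the combinatorial bounds
  concern their vertex sets, which are equally many.\<close>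

lemma num_components_del_verts_Tbar:
  "num_components (del_verts (Tbar X) S) = card (pre_digraph.sccs_verts (del_verts (Tbar X) S))"
  unfolding num_components_def
  using wf_digraph.card_sccs_verts[OF wf_del_verts_Tbar] by simp

text \<open>Surviving disjoint pairs are joined by arcs in both directions and hence share a strong
  component.\<close>

lemma cross_intersecting_components:
  "cross_intersecting (pre_digraph.sccs_verts (del_verts (Tbar X) S))"
proof -
  let ?D = "del_verts (Tbar X) S"
  interpret D: wf_digraph ?D
    by (rule wf_del_verts_Tbar)
  show ?thesis
  proof
    fix A e
    assume A: "A \<in> D.sccs_verts"
    show "A \<noteq> {}"
      using A by (simp add: D.in_sccs_verts_conv_reachable)
    show "card e = 2" if "e \<in> A"
      using D.sccs_verts_subsets[OF A] that unfolding verts_del_verts_Tbar by blast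
    fix B f
    assume B: "B \<in> D.sccs_verts" and "A \<noteq> B"
    show disj: "A \<inter> B = {}"
      using A B \<open>A \<noteq> B\<close> by (rule D.sccs_verts_disjoint)
    show "e \<inter> f \<noteq> {}" if "e \<in> A" "f \<in> B"
    proof
      assume "e \<inter> f = {}"
      moreover have "e \<in> pairs X - S" "f \<in> pairs X - S"
        using D.sccs_verts_subsets A B that unfolding verts_del_verts_Tbar by blast+
      ultimately have "e \<rightarrow>\<^bsub>?D\<^esub> f" "f \<rightarrow>\<^bsub>?D\<^esub> e"
        unfolding dominates_del_verts_Tbar by blast+
      then have "e \<rightarrow>\<^sup>*\<^bsub>?D\<^esub> f" "f \<rightarrow>\<^sup>*\<^bsub>?D\<^esub> e"
        by (blast intro: D.reachable_adjI)+
      moreover have "f \<notin> A"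
        using disj that by blast
      ultimately show False
        using A that unfolding D.in_sccs_verts_conv_reachable by blast
    qed
  qed
qed

text \<open>The components cover all surviving pairs, so \<open>S\<close> is the complement of their
  union and \<open>toughness_bound\<close> can be divided by \<open>c\<close>.\<close>

lemma toughness_bound_Tbar:
  assumes v: "card X \<ge> 6" and S: "disconnecting_set (Tbar X) S"
  defines "c \<equiv> num_components (del_verts (Tbar X) S)"
  shows "real (card X) / 2 - 1 \<le> real (card S) / real c"
    and "real (card S) / real c = real (card X) / 2 - 1 \<Longrightarrow> \<exists>x\<in>X. S = pairs X - star X x"
proof -
  let ?P = "pre_digraph.sccs_verts (del_verts (Tbar X) S)"
  interpret cross_intersecting ?P
    by (rule cross_intersecting_components)
  have c: "c = card ?P"
    by (simp add: c_def num_components_del_verts_Tbar)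
  have sub: "S \<subseteq> pairs X" and c2: "c \<ge> 2"
    using S unfolding disconnecting_set_def verts_Tbar c_def by blast+
  have U: "\<Union>?P = pairs X - S"
    by (simp only: Union_sccs_verts[OF wf_del_verts_Tbar] verts_del_verts_Tbar)
  have S_eq: "pairs X - \<Union>?P = S"
    unfolding U using sub by blast
  have P: "card ?P \<ge> 2" "\<Union>?P \<subseteq> pairs X"
    using c c2 U by auto
  note bound = toughness_bound[OF X v P(2,1), unfolded S_eq, folded c]
  show "real (card X) / 2 - 1 \<le> real (card S) / real c"
    using bound(1) c2 by (simp add: pos_le_divide_eq mult.commute)
  show "\<exists>x\<in>X. S = pairs X - star X x" if "real (card S) / real c = real (card X) / 2 - 1"
  proof -
    have "real c * (real (card X) / 2 - 1) = real (card S)"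
      using that c2 by (simp add: nonzero_divide_eq_eq mult.commute)
    then obtain x where "x \<in> X" "\<Union>?P = star X x"
      using bound(2) by blast
    then show ?thesis
      using S_eq by auto
  qed
qed

text \<open>The bound is attained: the surviving star has no arcs, so its \<open>v - 1\<close> pairs
  are isolated, where \<open>v\<close> is the size of \<open>X\<close>, and
  \<open>(v - 1) * (v - 2) / 2\<close> pairs have been deleted.\<close>

lemma star_complement_Tbar:
  assumes v: "card X \<ge> 6" and x: "x \<in> X"
  defines "S \<equiv> pairs X - star X x"
  shows "disconnecting_set (Tbar X) S"
    and "real (card S) / real (num_components (del_verts (Tbar X) S)) = real (card X) / 2 - 1"
proof -
  have "pairs X - S = star X x"
    by (auto simp: S_def)
  then have "pre_digraph.sccs_verts (del_verts (Tbar X) S) = (\<lambda>e. {e}) ` star X x"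
    using sccs_verts_arcless[OF wf_del_verts_Tbar, of S]
    unfolding dominates_del_verts_Tbar verts_del_verts_Tbar by blast
  then have c: "num_components (del_verts (Tbar X) S) = card X - 1"
    unfolding num_components_del_verts_Tbar using card_star[OF x] by (simp add: card_image)
  have "S \<subseteq> verts (Tbar X)"
    unfolding verts_Tbar S_def by blast
  then show "disconnecting_set (Tbar X) S"
    using c v by (simp add: disconnecting_set_def)
  have fin: "finite (star X x)"
    using X by simp
  have "card S = (card X choose 2) - (card X - 1)"
    unfolding S_def card_pairs[OF X, symmetric] card_star[OF x, symmetric]
    by (rule card_Diff_subset[OF fin]) blast
  moreover have "card (star X x) \<le> card (pairs X)"
    by (rule card_mono) (use X in auto)
  then have "card X - 1 \<le> card X choose 2"
    unfolding card_pairs[OF X] card_star[OF x] .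
  ultimately have "2 * real (card S) = (real (card X) - 1) * (real (card X) - 2)"
    using two_real_choose_2[of "card X"] v by (simp add: of_nat_diff algebra_simps)
  then show "real (card S) / real (num_components (del_verts (Tbar X) S)) = real (card X) / 2 - 1"
    unfolding c using v by (simp add: of_nat_diff field_simps)
qed

lemma toughness_Tbar:
  assumes v: "card X \<ge> 6"
  shows "toughness (Tbar X) = real (card X) / 2 - 1"
  unfolding toughness_def
proof (rule Min_eqI)
  let ?q = "\<lambda>S. real (card S) / real (num_components (del_verts (Tbar X) S))"
  \<comment> \<open>\<open>Min\<close> needs a finite set of quotients.\<close>
  have "{S. disconnecting_set (Tbar X) S} \<subseteq> Pow (pairs X)"
    unfolding disconnecting_set_def verts_Tbar by blast
  then have "finite {S. disconnecting_set (Tbar X) S}"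
    by (rule finite_subset) (simp add: X)
  then show "finite {?q S | S. disconnecting_set (Tbar X) S}"
    by simp
  show "real (card X) / 2 - 1 \<le> r" if "r \<in> {?q S | S. disconnecting_set (Tbar X) S}" for r
    using that toughness_bound_Tbar(1)[OF v] by blast
  obtain x where "x \<in> X"
    using v by fastforce
  then show "real (card X) / 2 - 1 \<in> {?q S | S. disconnecting_set (Tbar X) S}"
    using star_complement_Tbar[OF v] by force
qed

text \<open>This is the Erdos-Ko-Rado bound for pairs. An independent set with at least four members
  lies in a star by \<open>common_vertex\<close>; a smaller one has at most three members, and a
  star has at least three.\<close>

lemma maximum_independent_set_star:
  assumes v: "card X \<ge> 4" and x: "x \<in> X"
  shows "maximum_independent_set (Tbar X) (star X x)"
  unfolding maximum_independent_set_def
proof (intro conjI allI impI)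
  show "independent_set (Tbar X) (star X x)"
    unfolding independent_set_def verts_Tbar dominates_Tbar by blast
  fix J
  assume "independent_set (Tbar X) J"
  then have J: "J \<subseteq> pairs X" "\<And>e f. e \<in> J \<Longrightarrow> f \<in> J \<Longrightarrow> e \<inter> f \<noteq> {}"
    unfolding independent_set_def verts_Tbar dominates_Tbar by blast+
  \<comment> \<open>With singleton parts, the cross-intersection condition becomes pairwise
    intersection within \<open>J\<close>.\<close>
  interpret cross_intersecting "(\<lambda>e. {e}) ` J"
    by unfold_locales (use J in auto)
  show "card J \<le> card (star X x)"
  proof (cases "card J \<ge> 4")
    case True
    then have "card ((\<lambda>e. {e}) ` J) \<ge> 4"
      by (simp add: card_image)
    then obtain y where "\<And>e. e \<in> J \<Longrightarrow> y \<in> e"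
      by (rule common_vertex) auto
    then have sub: "J \<subseteq> star X y"
      using J(1) by blast
    moreover have "J \<noteq> {}"
      using True by auto
    ultimately have y: "y \<in> X"
      by blast
    have "card J \<le> card (star X y)"
      by (rule card_mono[OF _ sub]) (simp add: X)
    then show ?thesis
      using card_star[OF x] card_star[OF y] by simp
  next
    case False
    then show ?thesis
      unfolding card_star[OF x] using v by linarith
  qed
qed

lemma out_degree_Tbar:
  assumes e: "e \<in> pairs X"
  shows "out_degree (Tbar X) e = (card X - 2) choose 2"
proof -
  have "(e, f) \<in> parcs (complement_graph (triangular_graph X)) \<longleftrightarrow> f \<in> pairs (X - e)" for f
    unfolding parcs_complement_triangular_graph using e by blast
  then have "out_arcs (Tbar X) e = Pair e ` pairs (X - e)"
    unfolding out_arcs_def with_proj_simps by force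
  then have "out_degree (Tbar X) e = card (pairs (X - e))"
    by (simp add: out_degree_def card_image inj_on_def)
  also have "\<dots> = card (X - e) choose 2"
    using X by (simp only: card_pairs finite_Diff)
  also have "card (X - e) = card X - 2"
    using e X finite_subset by (subst card_Diff_subset) auto
  finally show ?thesis .
qed

end

theorem theorem4p3:
  fixes X :: "'a set" and v :: nat
  assumes "finite X" and "card X = v" and "v \<ge> 6"
  shows "let G = with_proj (complement_graph (triangular_graph X));
             k = (v - 2) choose 2
         in (\<forall>x\<in>verts G. out_degree G x = k)
          \<and> toughness G = real v / 2 - 1
          \<and> (\<forall>vs. distinct vs \<and> set vs = verts G \<longrightarrow>
               real v / 2 - 1 = real k / (- smallest_eigenvalue (adjacency_matrix G vs)))
          \<and> (\<forall>S. disconnecting_set G S \<and>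
                 real (card S) / real (num_components (del_verts G S)) = real v / 2 - 1 \<longrightarrow>
               (\<exists>I. maximum_independent_set G I \<and> S = verts G - I))"
proof -
  have X: "finite X" "card X \<ge> 6" "card X \<ge> 3" "card X \<ge> 4" and v: "v = card X"
    using assms by auto
  have "real v / 2 - 1 = real ((v - 2) choose 2) / (- smallest_eigenvalue (adjacency_matrix (Tbar X) vs))"
    if "distinct vs" "set vs = verts (Tbar X)" for vs
  proof -
    have "2 * real ((v - 2) choose 2) = (real v - 2) * (real v - 3)"
      using two_real_choose_2[of "v - 2"] assms(3) by (simp add: of_nat_diff)
    \<comment> \<open>The degree factors as the toughness times \<open>v - 3\<close>, and
      \<open>v - 3\<close> is minus the smallest eigenvalue.\<close>
    then have "real ((v - 2) choose 2) = (real v / 2 - 1) * (real v - 3)"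
      by (simp add: field_simps)
    moreover have "smallest_eigenvalue (adjacency_matrix (Tbar X) vs) = - (real v - 3)"
      using smallest_eigenvalue_Tbar[OF X(1,3) that(1)] that(2) unfolding verts_Tbar v by blast
    moreover have "real v - 3 \<noteq> 0"
      using assms(3) by simp
    ultimately show ?thesis
      by (simp only: minus_minus nonzero_mult_div_cancel_right not_False_eq_True)
  qed
  moreover have "\<exists>I. maximum_independent_set (Tbar X) I \<and> S = verts (Tbar X) - I"
    if "disconnecting_set (Tbar X) S"
      "real (card S) / real (num_components (del_verts (Tbar X) S)) = real v / 2 - 1" for S
  proof -
    from toughness_bound_Tbar(2)[OF X(1,2) that[unfolded v]]
    obtain x where "x \<in> X" "S = pairs X - star X x" ..
    then show ?thesis
      unfolding verts_Tbar using maximum_independent_set_star[OF X(1,4)] by blast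
  qed
  moreover have "out_degree (Tbar X) e = (v - 2) choose 2" if "e \<in> verts (Tbar X)" for e
    using out_degree_Tbar[OF X(1)] that unfolding verts_Tbar v .
  moreover have "toughness (Tbar X) = real v / 2 - 1"
    unfolding v by (rule toughness_Tbar[OF X(1,2)])
  ultimately show ?thesis
    unfolding Let_def by blast
qed

end
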